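(* Signed sets as objects and cobordisms $f:A\Rrightarrow B$ as morphisms, with composition $\triangleleft$ and with identities $\operatorname{id}(A):A\Rrightarrow A$ given by $|\operatorname{id}(A)|=\operatorname{id}(|A|)$, form a category. It extends the category of finite sets and matchings: matchings correspond to the cobordisms $f:A\Rrightarrow B$ with $A,B\ge 0$, via $f\mapsto |f|:A\Rrightarrow B$, and this correspondence is functorial, i.e. if $A,B,C\ge 0$ and $f:A\Rrightarrow B$, $g:B\Rrightarrow C$ are cobordisms, then $$|f\triangleleft g|=|f|\triangleleft|g|: A\Rrightarrow C,$$ where on the right $\triangleleft$ is ordinary composition of matchings in natural order, $(u\triangleleft v)(x)=v(u(x))$.
   Context: A matching is a bijection between finite sets, written $P\Rrightarrow Q$. $X+Y$ denotes disjoint union, treated as strictly commutative and associative by the usual identifications; $X,Y$ are regarded as subsets of $X+Y$. For matchings $u:P\Rrightarrow Q$ and $v:R\Rrightarrow S$, $u+v:P+R\Rrightarrow Q+S$ is their disjoint union. Cancellation: if $F:P+E\Rrightarrow Q+E$ is a matching of finite sets (the two copies of $E$ being identified), then $\operatorname{cancel}(E,F):P\Rrightarrow Q$ is the matching sending $p$ to the first element outside the summand $E$ among $F(p),F(F(p)),\dots$. A signed set is an ordered pair $A=\langle A^+,A^-\rangle$ of finite sets; $|A|=A^+ + A^-$. $0$ denotes the empty set. An unsigned (finite) set $S$ is identified with the signed set $\langle S,0\rangle$; one writes $A\ge 0$ if $A$ is unsigned, i.e. $A^-=0$, in which case $A=A^+$. A cobordism $f:A\Rrightarrow B$ of signed sets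 is a triple $(|f|,A,B)$ where $|f|:A^+ + B^-\Rrightarrow A^- + B^+$ is a matching; for $A,B\ge0$ this is a matching $|f|:A\Rrightarrow B$. For the identity, $|\operatorname{id}(A)|:A^+ + A^-\Rrightarrow A^- + A^+$ is the identity map of $|A|$ (sending $A^+$ to $A^+$ and $A^-$ to $A^-$ identically). Composition: for cobordisms $f:A\Rrightarrow B$ and $g:B\Rrightarrow C$, the disjoint union gives a matching $|f|+|g|: A^+ + |B| + C^-\Rrightarrow A^- + |B| + C^+$, and $f\triangleleft g:A\Rrightarrow C$ is the cobordism with $|f\triangleleft g|=\operatorname{cancel}(|B|,|f|+|g|): A^+ + C^-\Rrightarrow A^- + C^+$. (The sets at different positions in a chain are treated as separate summands even if they happen to be equal.) *)

theory Defs
  imports Main "HOL-Library.FuncSet"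
begin

locale category =
  fixes Obj :: "'o set"
    and Hom :: "'o \<Rightarrow> 'o \<Rightarrow> 'm set"
    and Id :: "'o \<Rightarrow> 'm"
    and Comp :: "'m \<Rightarrow> 'm \<Rightarrow> 'm"
      \<comment> \<open>diagrammatic order: \<open>Comp f g\<close> is first \<open>f\<close>, then \<open>g\<close>\<close>
  assumes hom_disjoint:
      "\<lbrakk>A \<in> Obj; B \<in> Obj; A' \<in> Obj; B' \<in> Obj; f \<in> Hom A B; f \<in> Hom A' B'\<rbrakk>
        \<Longrightarrow> A = A' \<and> B = B'"
    and Id_in_hom: "A \<in> Obj \<Longrightarrow> Id A \<in> Hom A A"
    and Comp_in_hom:
      "\<lbrakk>A \<in> Obj; B \<in> Obj; C \<in> Obj; f \<in> Hom A B; g \<in> Hom B C\<rbrakk> \<Longrightarrow> Comp f g \<in> Hom A C"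
    and Comp_Id_left: "\<lbrakk>A \<in> Obj; B \<in> Obj; f \<in> Hom A B\<rbrakk> \<Longrightarrow> Comp (Id A) f = f"
    and Comp_Id_right: "\<lbrakk>A \<in> Obj; B \<in> Obj; f \<in> Hom A B\<rbrakk> \<Longrightarrow> Comp f (Id B) = f"
    and Comp_assoc:
      "\<lbrakk>A \<in> Obj; B \<in> Obj; C \<in> Obj; D \<in> Obj; f \<in> Hom A B; g \<in> Hom B C; h \<in> Hom C D\<rbrakk>
        \<Longrightarrow> Comp (Comp f g) h = Comp f (Comp g h)"

text \<open>A matching carries its domain and codomain. The underlying function is required to be
  extensional on the domain, so that equality of matchings is equality of bijections.\<close>

datatype ('p, 'q) matching =
  Matching (mdom: "'p set") (mcod: "'q set") (app: "'p \<Rightarrow> 'q")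

definition matchings :: "'p set \<Rightarrow> 'q set \<Rightarrow> ('p, 'q) matching set" where
  "matchings P Q =
    {u. mdom u = P \<and> mcod u = Q \<and> finite P \<and> finite Q
      \<and> app u \<in> extensional P \<and> bij_betw (app u) P Q}"

definition finite_sets :: "'p set set" where
  "finite_sets = {S. finite S}"

definition id_matching :: "'p set \<Rightarrow> ('p, 'p) matching" where
  "id_matching P = Matching P P (\<lambda>x\<in>P. x)"

definition matching_comp ::
    "('p, 'q) matching \<Rightarrow> ('q, 'r) matching \<Rightarrow> ('p, 'r) matching" (infixl \<open>\<lhd>\<^sub>m\<close> 70) where
  "u \<lhd>\<^sub>m v = Matching (mdom u) (mcod v) (\<lambda>x\<in>mdom u. app v (app u x))"

definition matching_sum ::
    "('p, 'q) matching \<Rightarrow> ('r, 's) matching \<Rightarrow> ('p + 'r, 'q + 's) matching" (infixl \<open>+\<^sub>m\<close> 65) where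
  "u +\<^sub>m v = Matching (mdom u <+> mdom v) (mcod u <+> mcod v)
    (\<lambda>x\<in>mdom u <+> mdom v. map_sum (app u) (app v) x)"

text \<open>\<open>cancel_iter F p n\<close> is the \<open>n + 1\<close>-st element of the sequence \<open>F(p), F(F(p)), \<dots>\<close>. The
  summand \<open>E\<close> consists of the elements \<open>Inr e\<close> on either side; once the sequence has reached an
  element \<open>Inl q\<close> of the other summand of the codomain, it is continued as a constant.\<close>

primrec cancel_iter :: "('p + 'e, 'q + 'e) matching \<Rightarrow> 'p \<Rightarrow> nat \<Rightarrow> 'q + 'e" where
  "cancel_iter F p 0 = app F (Inl p)"
| "cancel_iter F p (Suc n) =
    (case cancel_iter F p n of Inl q \<Rightarrow> Inl q | Inr e \<Rightarrow> app F (Inr e))"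

definition cancel :: "'e set \<Rightarrow> ('p + 'e, 'q + 'e) matching \<Rightarrow> ('p, 'q) matching" where
  "cancel E F = Matching (Inl -` mdom F) (Inl -` mcod F)
    (\<lambda>p\<in>Inl -` mdom F.
      projl (cancel_iter F p (LEAST n. cancel_iter F p n \<notin> Inr ` E)))"

text \<open>The two components of a signed set need not be disjoint as subsets of \<open>'a\<close>.\<close>

datatype 'a signed_set = Signed (pos: "'a set") (neg: "'a set")

definition signed_sets :: "'a signed_set set" where
  "signed_sets = {A. finite (pos A) \<and> finite (neg A)}"

definition total_set :: "'a signed_set \<Rightarrow> ('a + 'a) set" where
  "total_set A = pos A <+> neg A"

definition nonneg :: "'a signed_set \<Rightarrow> bool" where
  "nonneg A \<longleftrightarrow> neg A = {}"

text \<open>In \<open>|f| : A\<^sup>+ + B\<^sup>- \<Rrightarrow> A\<^sup>- + B\<^sup>+\<close> the tag \<open>Inl\<close> marks elements of \<open>A\<close> and the tag \<open>Inr\<close>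
  elements of \<open>B\<close>, in the domain as well as in the codomain.\<close>

datatype ('a, 'b) cobordism =
  Cobordism (cmatching: "('a + 'b, 'a + 'b) matching")
    (csource: "'a signed_set") (ctarget: "'b signed_set")

definition cobordisms :: "'a signed_set \<Rightarrow> 'b signed_set \<Rightarrow> ('a, 'b) cobordism set" where
  "cobordisms A B =
    {f. csource f = A \<and> ctarget f = B \<and> A \<in> signed_sets \<and> B \<in> signed_sets
      \<and> cmatching f \<in> matchings (pos A <+> neg B) (neg A <+> pos B)}"

text \<open>The domain of \<open>|id(A)|\<close> is \<open>A\<^sup>+ + A\<^sup>-\<close> and its codomain is \<open>A\<^sup>- + A\<^sup>+\<close>. Under the
  identification of these two sums, the identity of \<open>|A|\<close> exchanges the tags.\<close>

definition id_cobordism :: "'a signed_set \<Rightarrow> ('a, 'a) cobordism" where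
  "id_cobordism A = Cobordism
    (Matching (pos A <+> neg A) (neg A <+> pos A)
      (\<lambda>x\<in>pos A <+> neg A. case x of Inl a \<Rightarrow> Inr a | Inr a \<Rightarrow> Inl a))
    A A"

text \<open>The identifications
  \<open>(A\<^sup>+ + C\<^sup>-) + (B\<^sup>+ + B\<^sup>-) = (A\<^sup>+ + B\<^sup>-) + (B\<^sup>+ + C\<^sup>-)\<close> and
  \<open>(A\<^sup>- + B\<^sup>+) + (B\<^sup>- + C\<^sup>+) = (A\<^sup>- + C\<^sup>+) + (B\<^sup>+ + B\<^sup>-)\<close>.\<close>

fun regroup_dom :: "('a + 'c) + ('b + 'b) \<Rightarrow> ('a + 'b) + ('b + 'c)" where
  "regroup_dom (Inl (Inl a)) = Inl (Inl a)"
| "regroup_dom (Inl (Inr c)) = Inr (Inr c)"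
| "regroup_dom (Inr (Inl b)) = Inr (Inl b)"
| "regroup_dom (Inr (Inr b)) = Inl (Inr b)"

fun regroup_cod :: "('a + 'b) + ('b + 'c) \<Rightarrow> ('a + 'c) + ('b + 'b)" where
  "regroup_cod (Inl (Inl a)) = Inl (Inl a)"
| "regroup_cod (Inl (Inr b)) = Inr (Inl b)"
| "regroup_cod (Inr (Inl b)) = Inr (Inr b)"
| "regroup_cod (Inr (Inr c)) = Inl (Inr c)"

text \<open>The matching \<open>|f| + |g| : (A\<^sup>+ + C\<^sup>-) + |B| \<Rrightarrow> (A\<^sup>- + C\<^sup>+) + |B|\<close>.\<close>

definition cobordism_union ::
    "('a, 'b) cobordism \<Rightarrow> ('b, 'c) cobordism
      \<Rightarrow> (('a + 'c) + ('b + 'b), ('a + 'c) + ('b + 'b)) matching" where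
  "cobordism_union f g =
    (let A = csource f; B = ctarget f; C = ctarget g;
         D = (pos A <+> neg C) <+> total_set B
     in Matching D ((neg A <+> pos C) <+> total_set B)
          (\<lambda>x\<in>D. regroup_cod (app (cmatching f +\<^sub>m cmatching g) (regroup_dom x))))"

definition cobordism_comp ::
    "('a, 'b) cobordism \<Rightarrow> ('b, 'c) cobordism \<Rightarrow> ('a, 'c) cobordism" (infixl \<open>\<lhd>\<close> 70) where
  "f \<lhd> g = Cobordism (cancel (total_set (ctarget f)) (cobordism_union f g))
    (csource f) (ctarget g)"

text \<open>For \<open>A, B \<ge> 0\<close> the matching \<open>|f| : A\<^sup>+ + 0 \<Rrightarrow> 0 + B\<^sup>+\<close>, read as a matching \<open>A\<^sup>+ \<Rrightarrow> B\<^sup>+\<close>.\<close>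

definition unsigned_matching :: "('a, 'b) cobordism \<Rightarrow> ('a, 'b) matching" where
  "unsigned_matching f = Matching (pos (csource f)) (pos (ctarget f))
    (\<lambda>a\<in>pos (csource f). projr (app (cmatching f) (Inl a)))"

end

theory Submission
  imports Defs
begin

text \<open>A cancellation is computed by following the orbit of a point until it leaves the cancelled
  summand. Injectivity and finiteness force every orbit that starts outside the summand to leave
  it, and distinct starting points to end at distinct points. For associativity, both
  \<open>(f \<lhd> g) \<lhd> h\<close> and \<open>f \<lhd> (g \<lhd> h)\<close> turn out to follow the same deterministic walk
  through \<open>f\<close>, \<open>g\<close> and \<open>h\<close> simultaneously; the inner composite merely performs several
  steps of this walk at once.\<close>

section \<open>Cancellation of matchings\<close>

lemma matchingsD:
  assumes "u \<in> matchings P Q"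
  shows "mdom u = P" "mcod u = Q" "finite P" "finite Q" "app u \<in> extensional P"
    "bij_betw (app u) P Q" "inj_on (app u) P" "\<And>x. x \<in> P \<Longrightarrow> app u x \<in> Q"
  using assms by (auto simp: matchings_def bij_betw_def)

lemma matching_eqI:
  assumes "u \<in> matchings P Q" "v \<in> matchings P Q" "\<And>x. x \<in> P \<Longrightarrow> app u x = app v x"
  shows "u = v"
proof (rule matching.expand)
  have "app u = app v"
    using assms extensionalityI[OF matchingsD(5) matchingsD(5)] by blast
  then show "mdom u = mdom v \<and> mcod u = mcod v \<and> app u = app v"
    using assms(1,2) by (simp add: matchingsD)
qed

text \<open>A form of the cancellation orbit without step counter and \<open>LEAST\<close>, open to
  rule induction. Orbits may also start at a point of the summand \<open>E\<close>, as the
  termination argument requires. Re-entering at \<open>Inr e\<close> is the identification of the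
  two copies of \<open>E\<close>.\<close>

inductive exits :: "('p + 'e, 'q + 'e) matching \<Rightarrow> 'p + 'e \<Rightarrow> 'q \<Rightarrow> bool"
  for F where
  exits_stop: "x \<in> mdom F \<Longrightarrow> app F x = Inl q \<Longrightarrow> exits F x q"
| exits_step: "x \<in> mdom F \<Longrightarrow> app F x = Inr e \<Longrightarrow> exits F (Inr e) q \<Longrightarrow> exits F x q"

lemma cancel_iter_constant:
  assumes "cancel_iter F p n = Inl q" "n \<le> m"
  shows "cancel_iter F p m = Inl q"
  using assms(2,1) by (induction m rule: dec_induct) auto

lemma exits_imp_cancel_iter:
  assumes "exits F (Inl p) q"
  shows "\<exists>n. cancel_iter F p n = Inl q"
proof -
  \<comment> \<open>After the first step the orbit starts at some \<open>Inr e\<close>, no longer at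
    \<open>Inl p\<close>. The induction is therefore generalised to any time \<open>n\<close> at
    which the iteration stands at the start of the remaining orbit.\<close>
  have later: "\<exists>m. cancel_iter F p m = Inl q"
    if "exits F x q" "x = Inr e" "cancel_iter F p n = Inr e" for x e n
    using that
  proof (induction arbitrary: e n)
    case (exits_stop x q)
    then have "cancel_iter F p (Suc n) = Inl q"
      by simp
    then show ?case
      by blast
  next
    case (exits_step x e' q)
    then have "cancel_iter F p (Suc n) = Inr e'"
      by simp
    then show ?case
      using exits_step.IH by blast
  qed
  from assms show ?thesis
  proof cases
    case exits_stop
    then have "cancel_iter F p 0 = Inl q"
      by simp
    then show ?thesis
      by blast
  next
    case (exits_step e)
    then have "cancel_iter F p 0 = Inr e"
      by simp
    then show ?thesis
      using later exits_step by blast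
  qed
qed

lemma cancel_iter_in_codomain:
  assumes "F \<in> matchings (P <+> E) (Q <+> E)" "p \<in> P"
  shows "cancel_iter F p n \<in> Q <+> E"
  by (induction n) (use assms in \<open>auto split: sum.splits intro!: matchingsD(8)\<close>)

text \<open>The least index in \<open>cancel\<close> is at most \<open>n\<close>. Its value lies
  outside the summand, so it is some \<open>Inl q'\<close>, and the constant continuation from there
  forces \<open>q' = q\<close>. Hence any index with an \<open>Inl\<close> value computes the
  cancellation.\<close>

lemma app_cancel_if_cancel_iter:
  assumes F: "F \<in> matchings (P <+> E) (Q <+> E)" and p: "p \<in> P"
    and n: "cancel_iter F p n = Inl q"
  shows "app (cancel E F) p = q"
proof -
  define l where "l = (LEAST n. cancel_iter F p n \<notin> Inr ` E)"
  have "cancel_iter F p n \<notin> Inr ` E"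
    using n by auto
  then have "cancel_iter F p l \<notin> Inr ` E" "l \<le> n"
    unfolding l_def by (rule LeastI, rule Least_le)
  then obtain q' where q': "cancel_iter F p l = Inl q'"
    using cancel_iter_in_codomain[OF F p, of l] by auto
  then have "q' = q"
    using cancel_iter_constant[OF q' \<open>l \<le> n\<close>] n by simp
  then show ?thesis
    using p q' matchingsD(1)[OF F] by (auto simp: cancel_def l_def[symmetric])
qed

section \<open>Every orbit leaves the cancelled summand\<close>

lemma exits_exists:
  assumes F: "F \<in> matchings (P <+> E) (Q <+> E)" and p: "p \<in> P"
  shows "\<exists>q. exits F (Inl p) q"
proof (rule ccontr)
  assume no_exit: "\<nexists>q. exits F (Inl p) q"
  \<comment> \<open>\<open>F\<close> permutes the points of \<open>E\<close> that never exit, so it sends nothing else to them.\<close>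
  define bad where "bad = {x \<in> Inr ` E. \<nexists>q. exits F x q}"
  have step: "\<exists>e\<in>E. app F x = Inr e \<and> Inr e \<in> bad"
    if "x \<in> P <+> E" "\<nexists>q. exits F x q" for x
  proof -
    have "app F x \<in> Q <+> E" "x \<in> mdom F"
      using matchingsD(1,8)[OF F] that by auto
    then show ?thesis
      using that exits_stop[of x F] exits_step[of x F] by (fastforce simp: bad_def)
  qed
  \<comment> \<open>This is \<open>F\<close> on never-exiting points, with the value moved from the
    codomain copy of \<open>E\<close> to the domain copy. By \<open>step\<close> the value carries
    the tag \<open>Inr\<close>, so \<open>projr\<close> loses nothing.\<close>
  define \<phi> where "\<phi> x = (Inr (projr (app F x)) :: 'a + 'b)" for x
  have \<phi>: "\<phi> x \<in> bad \<and> app F x = Inr (projr (\<phi> x))"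
    if "x \<in> P <+> E" "\<nexists>q. exits F x q" for x
    using step[OF that] by (auto simp: \<phi>_def)
  have bad_dom: "x \<in> P <+> E \<and> (\<nexists>q. exits F x q)" if "x \<in> bad" for x
    using that by (auto simp: bad_def)
  have "finite (P <+> E)"
    by (rule matchingsD[OF F])
  then have "finite bad"
    by (rule rev_finite_subset) (use bad_dom in auto)
  moreover have "\<phi> ` bad \<subseteq> bad"
    using \<phi> bad_dom by blast
  moreover have "inj_on \<phi> bad"
    by (rule inj_onI) (metis \<phi> bad_dom inj_onD[OF matchingsD(7)[OF F]])
  ultimately have "\<phi> ` bad = bad"
    by (rule endo_inj_surj)
  moreover have p_dom: "Inl p \<in> P <+> E"
    using p by auto
  \<comment> \<open>If \<open>p\<close> never exits, its image is a bad point, and surjectivity on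
    \<open>bad\<close> supplies a second preimage inside \<open>E\<close>. Injectivity of
    \<open>F\<close> forbids this, because \<open>p\<close> lies in the other summand.\<close>
  ultimately obtain x where "x \<in> bad" "\<phi> (Inl p) = \<phi> x"
    using \<phi>[OF p_dom no_exit] by blast
  then have "app F (Inl p) = app F x"
    using \<phi>[OF p_dom no_exit] \<phi>[of x] bad_dom by metis
  then have "Inl p = x"
    using inj_onD[OF matchingsD(7)[OF F]] p_dom bad_dom[OF \<open>x \<in> bad\<close>] by blast
  then show False
    using \<open>x \<in> bad\<close> by (auto simp: bad_def)
qed

lemma exits_cancel:
  assumes "F \<in> matchings (P <+> E) (Q <+> E)" "p \<in> P"
  shows "exits F (Inl p) (app (cancel E F) p)"
  using exits_exists[OF assms] exits_imp_cancel_iter app_cancel_if_cancel_iter[OF assms] by metis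

lemma exits_imp_orbit:
  assumes "exits F (Inl p) q"
  shows "\<exists>n. cancel_iter F p n = Inl q \<and> (\<forall>m<n. \<exists>e. cancel_iter F p m = Inr e)"
proof -
  define n where "n = (LEAST n. cancel_iter F p n = Inl q)"
  have n: "cancel_iter F p n = Inl q"
    unfolding n_def by (rule LeastI_ex) (rule exits_imp_cancel_iter[OF assms])
  have "\<exists>e. cancel_iter F p m = Inr e" if "m < n" for m
  proof (cases "cancel_iter F p m")
    case (Inl q')
    then have "q' = q"
      using cancel_iter_constant[OF Inl, of n] n that by simp
    then show ?thesis
      using not_less_Least[OF that[unfolded n_def]] Inl by simp
  qed blast
  then show ?thesis
    using n by blast
qed

text \<open>Both orbits are traced backwards. The hypotheses on earlier values make every step a
  genuine application of \<open>F\<close>, so by injectivity equal points have equal predecessors.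
  One orbit cannot reach its start before the other: its predecessor would be some
  \<open>Inl\<close>, the other's some \<open>Inr e\<close>. So both starts are reached together and
  agree.\<close>

lemma orbits_disjoint:
  assumes F: "F \<in> matchings (P <+> E) (Q <+> E)" and "p \<in> P" "p' \<in> P"
  shows "cancel_iter F p n = cancel_iter F p' n' \<Longrightarrow>
    \<forall>m<n. \<exists>e. cancel_iter F p m = Inr e \<Longrightarrow>
    \<forall>m<n'. \<exists>e. cancel_iter F p' m = Inr e \<Longrightarrow> p = p'"
proof (induction n arbitrary: n')
  have inj: "x = y" if "app F x = app F y" "x \<in> P <+> E" "y \<in> P <+> E" for x y
    using that inj_onD[OF matchingsD(7)[OF F]] by blast
  have E: "e \<in> E" if "cancel_iter F r k = Inr e" "r \<in> P" for r k e
    using cancel_iter_in_codomain[OF F that(2), of k] that(1) by auto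
  {
    case 0
    show ?case
    proof (cases n')
      case 0
      then show ?thesis
        using inj[of "Inl p" "Inl p'"] \<open>cancel_iter F p 0 = _\<close> assms by auto
    next
      case (Suc k)
      then obtain e where e: "cancel_iter F p' k = Inr e"
        using 0 by auto
      then show ?thesis
        using inj[of "Inl p" "Inr e"] E[OF e] 0 Suc assms by auto
    qed
  next
    case (Suc n)
    obtain e where e: "cancel_iter F p n = Inr e"
      using Suc.prems(2) by auto
    show ?case
    proof (cases n')
      case 0
      then show ?thesis
        using inj[of "Inl p'" "Inr e"] E[OF e] Suc.prems e assms by auto
    next
      case (Suc k)
      then obtain e' where e': "cancel_iter F p' k = Inr e'"
        using Suc.prems(3) by auto
      then have "e = e'"
        using inj[of "Inr e" "Inr e'"] E[OF e] E[OF e'] Suc Suc.prems e assms by auto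
      then show ?thesis
        using Suc.IH[of k] Suc.prems(2,3) e e' Suc by auto
    qed
  }
qed

theorem cancel_in_matchings:
  assumes F: "F \<in> matchings (P <+> E) (Q <+> E)"
  shows "cancel E F \<in> matchings P Q"
proof -
  have fin: "finite P" "finite E" "finite Q"
    using matchingsD(3,4)[OF F] by (auto simp: finite_Plus_iff)
  have dom: "Inl -` mdom F = P" "Inl -` mcod F = Q"
    using matchingsD(1,2)[OF F] by auto
  have maps: "app (cancel E F) p \<in> Q" if p: "p \<in> P" for p
    using exits_imp_cancel_iter[OF exits_cancel[OF F p]] cancel_iter_in_codomain[OF F p]
    by (metis InlI Inl_not_Inr PlusE sum.inject(1))
  have "inj_on (app (cancel E F)) P"
    by (rule inj_onI) (metis exits_imp_orbit exits_cancel[OF F] orbits_disjoint[OF F])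
  \<comment> \<open>Surjectivity is obtained by counting: \<open>P <+> E\<close> and
    \<open>Q <+> E\<close> have equal cardinality, so injectivity into \<open>Q\<close>
    suffices.\<close>
  moreover have "card P = card Q"
    using bij_betw_same_card[OF matchingsD(6)[OF F]] fin by (simp add: card_Plus)
  ultimately have "bij_betw (app (cancel E F)) P Q"
    using maps fin by (simp add: bij_betw_def card_image card_subset_eq image_subsetI)
  then show ?thesis
    using fin dom by (simp add: matchings_def cancel_def)
qed

section \<open>Composition of cobordisms\<close>

text \<open>The orbit of the cancellation without the regrouping maps. A state is a point of the
  domain of \<open>u\<close> or of \<open>v\<close>. A value of \<open>u\<close> in the middle set
  is fed to \<open>v\<close>, and one of \<open>v\<close> is fed back to \<open>u\<close>; other
  values end the walk. The premises on \<open>mdom\<close> later allow a step of a composite to be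
  expanded by \<open>walk_cobordism_comp\<close>.\<close>

inductive walk :: "('a + 'b, 'a + 'b) matching \<Rightarrow> ('b + 'c, 'b + 'c) matching \<Rightarrow>
    ('a + 'b) + ('b + 'c) \<Rightarrow> 'a + 'c \<Rightarrow> bool"
  for u v where
  walk_left_stop: "x \<in> mdom u \<Longrightarrow> app u x = Inl a \<Longrightarrow> walk u v (Inl x) (Inl a)"
| walk_left_step: "x \<in> mdom u \<Longrightarrow> app u x = Inr b \<Longrightarrow> walk u v (Inr (Inl b)) z \<Longrightarrow> walk u v (Inl x) z"
| walk_right_step: "y \<in> mdom v \<Longrightarrow> app v y = Inl b \<Longrightarrow> walk u v (Inl (Inr b)) z \<Longrightarrow> walk u v (Inr y) z"
| walk_right_stop: "y \<in> mdom v \<Longrightarrow> app v y = Inr c \<Longrightarrow> walk u v (Inr y) (Inr c)"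

lemma walk_deterministic:
  assumes "walk u v s z" "walk u v s z'"
  shows "z = z'"
  using assms
proof (induction arbitrary: z')
  case walk_left_stop
  from walk_left_stop(3) show ?case by cases (use walk_left_stop in auto)
next
  case walk_left_step
  from walk_left_step.prems show ?case by cases (metis walk_left_step.hyps walk_left_step.IH sum.inject Inl_Inr_False)+
next
  case walk_right_step
  from walk_right_step.prems show ?case by cases (metis walk_right_step.hyps walk_right_step.IH sum.inject Inl_Inr_False)+
next
  case walk_right_stop
  from walk_right_stop(3) show ?case by cases (use walk_right_stop in auto)
qed

lemma cobordismsD:
  assumes "f \<in> cobordisms A B"
  shows "csource f = A" "ctarget f = B" "A \<in> signed_sets" "B \<in> signed_sets"
    "cmatching f \<in> matchings (pos A <+> neg B) (neg A <+> pos B)"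
  using assms by (auto simp: cobordisms_def)

lemma cobordism_eqI:
  assumes "f \<in> cobordisms A B" "g \<in> cobordisms A B"
    and "\<And>x. x \<in> pos A <+> neg B \<Longrightarrow> app (cmatching f) x = app (cmatching g) x"
  shows "f = g"
proof (rule cobordism.expand)
  have "cmatching f = cmatching g"
    using cobordismsD(5)[OF assms(1)] cobordismsD(5)[OF assms(2)] assms(3) by (rule matching_eqI)
  then show "cmatching f = cmatching g \<and> csource f = csource g \<and> ctarget f = ctarget g"
    using assms(1,2) by (simp add: cobordismsD)
qed

section \<open>The union of two cobordisms as a matching\<close>

lemma regroup_dom_bij:
  "bij_betw regroup_dom ((P <+> S) <+> (Q <+> R)) ((P <+> R) <+> (Q <+> S))"
proof -
  have "inj_on regroup_dom ((P <+> S) <+> (Q <+> R))"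
    by (rule inj_onI) (elim PlusE; force)
  moreover have "regroup_dom ` ((P <+> S) <+> (Q <+> R)) = (P <+> R) <+> (Q <+> S)"
    by (force simp: image_iff Plus_def Bex_def)
  ultimately show ?thesis
    by (simp add: bij_betw_def)
qed

lemma regroup_cod_bij:
  "bij_betw regroup_cod ((P <+> Q) <+> (R <+> S)) ((P <+> S) <+> (Q <+> R))"
proof -
  have "inj_on regroup_cod ((P <+> Q) <+> (R <+> S))"
    by (rule inj_onI) (elim PlusE; force)
  moreover have "regroup_cod ` ((P <+> Q) <+> (R <+> S)) = (P <+> S) <+> (Q <+> R)"
    by (force simp: image_iff Plus_def Bex_def)
  ultimately show ?thesis
    by (simp add: bij_betw_def)
qed

lemma map_sum_bij:
  assumes "bij_betw u P Q" "bij_betw v R S"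
  shows "bij_betw (map_sum u v) (P <+> R) (Q <+> S)"
proof -
  have "inj_on (map_sum u v) (P <+> R)"
    by (rule inj_onI) (elim PlusE; use assms in \<open>auto simp: bij_betw_def dest: inj_onD\<close>)
  moreover have "map_sum u v ` (P <+> R) = Q <+> S"
    using assms by (auto simp: bij_betw_def Plus_def image_Un image_image)
  ultimately show ?thesis
    by (simp add: bij_betw_def)
qed

lemma app_cobordism_union:
  assumes f: "f \<in> cobordisms A B" and g: "g \<in> cobordisms B C"
    and x: "x \<in> (pos A <+> neg C) <+> total_set B"
  shows "app (cobordism_union f g) x =
    regroup_cod (map_sum (app (cmatching f)) (app (cmatching g)) (regroup_dom x))"
proof -
  have "regroup_dom x \<in> mdom (cmatching f) <+> mdom (cmatching g)"
    using bij_betw_apply[OF regroup_dom_bij x[unfolded total_set_def]]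
    by (simp add: matchingsD(1)[OF cobordismsD(5)[OF f]] matchingsD(1)[OF cobordismsD(5)[OF g]])
  then show ?thesis
    using x by (simp add: cobordism_union_def matching_sum_def Let_def cobordismsD[OF f] cobordismsD[OF g])
qed

lemma cobordism_union_in_matchings:
  assumes f: "f \<in> cobordisms A B" and g: "g \<in> cobordisms B C"
  shows "cobordism_union f g
    \<in> matchings ((pos A <+> neg C) <+> total_set B) ((neg A <+> pos C) <+> total_set B)"
proof -
  let ?D = "(pos A <+> neg C) <+> total_set B"
  let ?R = "(neg A <+> pos C) <+> total_set B"
  have "bij_betw (regroup_cod \<circ> (map_sum (app (cmatching f)) (app (cmatching g)) \<circ> regroup_dom)) ?D ?R"
    unfolding total_set_def
    by (intro bij_betw_trans[OF bij_betw_trans[OF regroup_dom_bij] regroup_cod_bij] map_sum_bij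
        matchingsD(6) cobordismsD(5) f g)
  then have "bij_betw (app (cobordism_union f g)) ?D ?R"
    using app_cobordism_union[OF f g] by (simp cong: bij_betw_cong)
  moreover have "finite ?D" "finite ?R"
    using cobordismsD(3,4)[OF f] cobordismsD(4)[OF g] by (auto simp: signed_sets_def total_set_def)
  ultimately show ?thesis
    by (simp add: matchings_def cobordism_union_def Let_def cobordismsD[OF f] cobordismsD[OF g])
qed

lemma cobordism_comp_in_cobordisms:
  assumes "f \<in> cobordisms A B" "g \<in> cobordisms B C"
  shows "f \<lhd> g \<in> cobordisms A C"
  using cancel_in_matchings[OF cobordism_union_in_matchings[OF assms]]
    cobordismsD[OF assms(1)] cobordismsD[OF assms(2)]
  by (simp add: cobordisms_def cobordism_comp_def)

lemma regroup_cod_eq_iff: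
  "regroup_cod (Inl x) = Inl z \<longleftrightarrow> (\<exists>a. x = Inl a \<and> z = Inl a)"
  "regroup_cod (Inl x) = Inr e \<longleftrightarrow> (\<exists>b. x = Inr b \<and> e = Inl b)"
  "regroup_cod (Inr y) = Inl z \<longleftrightarrow> (\<exists>c. y = Inr c \<and> z = Inr c)"
  "regroup_cod (Inr y) = Inr e \<longleftrightarrow> (\<exists>b. y = Inl b \<and> e = Inr b)"
  by (cases x; auto; cases y; auto)+

text \<open>One step of the union is one step of \<open>f\<close> or of \<open>g\<close>:
  \<open>regroup_dom\<close> selects which of them applies, and \<open>regroup_cod\<close> separates
  the values that stop from those in the middle set. A value in \<open>pos B\<close> goes on to
  \<open>g\<close>, one in \<open>neg B\<close> back to \<open>f\<close>.\<close>

lemma exits_cobordism_union_imp_walk: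
  assumes f: "f \<in> cobordisms A B" and g: "g \<in> cobordisms B C"
    and "exits (cobordism_union f g) x z"
  shows "walk (cmatching f) (cmatching g) (regroup_dom x) z"
  using assms(3)
proof induction
  note mdom = matchingsD(1)[OF cobordismsD(5)[OF f]] matchingsD(1)[OF cobordismsD(5)[OF g]]
    matchingsD(1)[OF cobordism_union_in_matchings[OF f g]]
  note app = app_cobordism_union[OF f g]
  {
    case (exits_stop x z)
    then show ?case
      by (fastforce simp: mdom app total_set_def regroup_cod_eq_iff intro: walk.intros)
  next
    case (exits_step x e z)
    then show ?case
      by (fastforce simp: mdom app total_set_def regroup_cod_eq_iff intro: walk.intros)
  }
qed


lemma walk_cobordism_comp:
  assumes f: "f \<in> cobordisms A B" and g: "g \<in> cobordisms B C" and x: "x \<in> pos A <+> neg C"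
  shows "walk (cmatching f) (cmatching g) (regroup_dom (Inl x)) (app (cmatching (f \<lhd> g)) x)"
  using exits_cobordism_union_imp_walk[OF f g
      exits_cancel[OF cobordism_union_in_matchings[OF f g] x]]
  by (simp add: cobordism_comp_def cobordismsD(2)[OF f])

text \<open>The tool for evaluating a concrete composite: exhibit one walk, and determinism
  identifies its end with the value of the composite.\<close>

lemma app_cobordism_comp_eqI:
  assumes "f \<in> cobordisms A B" "g \<in> cobordisms B C" "x \<in> pos A <+> neg C"
    and "walk (cmatching f) (cmatching g) (regroup_dom (Inl x)) z"
  shows "app (cmatching (f \<lhd> g)) x = z"
  using walk_deterministic[OF walk_cobordism_comp[OF assms(1-3)] assms(4)] .

section \<open>Associativity and units\<close>

text \<open>The common refinement of both bracketings: states are points of the domains of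
  \<open>u\<close>, \<open>v\<close> and \<open>w\<close>, and each middle set is crossed in either
  direction. Existence of such walks will come from the composites, uniqueness from
  determinism.\<close>

inductive walk3 :: "('a + 'b, 'a + 'b) matching \<Rightarrow> ('b + 'c, 'b + 'c) matching \<Rightarrow>
    ('c + 'd, 'c + 'd) matching \<Rightarrow> ('a + 'b) + ('b + 'c) + ('c + 'd) \<Rightarrow> 'a + 'd \<Rightarrow> bool"
  for u v w where
  walk3_1_stop: "app u x = Inl a \<Longrightarrow> walk3 u v w (Inl x) (Inl a)"
| walk3_1_step: "app u x = Inr b \<Longrightarrow> walk3 u v w (Inr (Inl (Inl b))) r \<Longrightarrow> walk3 u v w (Inl x) r"
| walk3_2_back: "app v y = Inl b \<Longrightarrow> walk3 u v w (Inl (Inr b)) r \<Longrightarrow> walk3 u v w (Inr (Inl y)) r"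
| walk3_2_step: "app v y = Inr c \<Longrightarrow> walk3 u v w (Inr (Inr (Inl c))) r \<Longrightarrow> walk3 u v w (Inr (Inl y)) r"
| walk3_3_back: "app w z = Inl c \<Longrightarrow> walk3 u v w (Inr (Inl (Inr c))) r \<Longrightarrow> walk3 u v w (Inr (Inr z)) r"
| walk3_3_stop: "app w z = Inr d \<Longrightarrow> walk3 u v w (Inr (Inr z)) (Inr d)"

lemma walk3_deterministic:
  assumes "walk3 u v w s r" "walk3 u v w s r'"
  shows "r = r'"
  using assms
proof (induction arbitrary: r')
  case walk3_1_stop
  from walk3_1_stop(2) show ?case by cases (use walk3_1_stop in auto)
next
  case walk3_1_step
  from walk3_1_step.prems show ?case by cases (metis walk3_1_step.hyps walk3_1_step.IH sum.inject Inl_Inr_False)+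
next
  case walk3_2_back
  from walk3_2_back.prems show ?case by cases (metis walk3_2_back.hyps walk3_2_back.IH sum.inject Inl_Inr_False)+
next
  case walk3_2_step
  from walk3_2_step.prems show ?case by cases (metis walk3_2_step.hyps walk3_2_step.IH sum.inject Inl_Inr_False)+
next
  case walk3_3_back
  from walk3_3_back.prems show ?case by cases (metis walk3_3_back.hyps walk3_3_back.IH sum.inject Inl_Inr_False)+
next
  case walk3_3_stop
  from walk3_3_stop(2) show ?case by cases (use walk3_3_stop in auto)
qed

text \<open>A walk through \<open>u\<close> and \<open>v\<close> is replayed as an initial segment
  of a walk through all three. The last two premises describe the continuation: an exit on the outer
  side ends the whole walk, an exit into the set shared with \<open>w\<close> is followed by a
  remaining walk to \<open>r\<close>.\<close>

lemma walk3_if_walk_left: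
  assumes "walk u v s z"
    and "\<And>a. z = Inl a \<Longrightarrow> r = Inl a"
    and "\<And>c. z = Inr c \<Longrightarrow> walk3 u v w (Inr (Inr (Inl c))) r"
  shows "walk3 u v w (map_sum id Inl s) r"
  using assms by induction (auto intro: walk3.intros)

lemma walk3_if_walk_right:
  assumes "walk v w s z"
    and "\<And>b. z = Inl b \<Longrightarrow> walk3 u v w (Inl (Inr b)) r"
    and "\<And>d. z = Inr d \<Longrightarrow> r = Inr d"
  shows "walk3 u v w (Inr s) r"
  using assms by induction (auto intro: walk3.intros)

text \<open>Each step of the composite expands into the inner walk given by
  \<open>walk_cobordism_comp\<close>, and the induction hypothesis supplies the continuation after
  it. The \<open>case\<close> expression sends a point of the composite's domain to its place in the
  domain of \<open>f\<close> or \<open>g\<close>.\<close>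

lemma walk3_if_walk_comp_left:
  assumes f: "f \<in> cobordisms A B" and g: "g \<in> cobordisms B C"
    and "walk (cmatching (f \<lhd> g)) w s r"
  shows "walk3 (cmatching f) (cmatching g) w
    (case s of Inl x \<Rightarrow> map_sum id Inl (regroup_dom (Inl x)) | Inr z \<Rightarrow> Inr (Inr z)) r"
  using assms(3)
proof induction
  note mdom = matchingsD(1)[OF cobordismsD(5)[OF cobordism_comp_in_cobordisms[OF f g]]]
  {
    case (walk_left_stop x a)
    then show ?case
      using walk_cobordism_comp[OF f g, of x] by (auto simp: mdom intro: walk3_if_walk_left)
  next
    case (walk_left_step x b r)
    then show ?case
      using walk_cobordism_comp[OF f g, of x] by (auto simp: mdom intro: walk3_if_walk_left)
  next
    case walk_right_step
    then show ?case
      by (auto intro: walk3.intros)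
  next
    case walk_right_stop
    then show ?case
      by (auto intro: walk3.intros)
  }
qed

lemma walk3_if_walk_comp_right:
  assumes g: "g \<in> cobordisms B C" and h: "h \<in> cobordisms C D"
    and "walk u (cmatching (g \<lhd> h)) s r"
  shows "walk3 u (cmatching g) (cmatching h)
    (case s of Inl x \<Rightarrow> Inl x | Inr y \<Rightarrow> Inr (regroup_dom (Inl y))) r"
  using assms(3)
proof induction
  note mdom = matchingsD(1)[OF cobordismsD(5)[OF cobordism_comp_in_cobordisms[OF g h]]]
  {
    case walk_left_stop
    then show ?case
      by (auto intro: walk3.intros)
  next
    case walk_left_step
    then show ?case
      by (auto intro: walk3.intros)
  next
    case (walk_right_step y b r)
    then show ?case
      using walk_cobordism_comp[OF g h, of y] by (auto simp: mdom intro: walk3_if_walk_right)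
  next
    case (walk_right_stop y d)
    then show ?case
      using walk_cobordism_comp[OF g h, of y] by (auto simp: mdom intro: walk3_if_walk_right)
  }
qed

lemma cobordism_comp_assoc:
  assumes f: "f \<in> cobordisms A B" and g: "g \<in> cobordisms B C" and h: "h \<in> cobordisms C D"
  shows "(f \<lhd> g) \<lhd> h = f \<lhd> (g \<lhd> h)"
proof (rule cobordism_eqI)
  note fg = cobordism_comp_in_cobordisms[OF f g] and gh = cobordism_comp_in_cobordisms[OF g h]
  show "(f \<lhd> g) \<lhd> h \<in> cobordisms A D" "f \<lhd> (g \<lhd> h) \<in> cobordisms A D"
    by (rule cobordism_comp_in_cobordisms[OF fg h], rule cobordism_comp_in_cobordisms[OF f gh])
  fix x assume x: "x \<in> pos A <+> neg D"
  note left = walk3_if_walk_comp_left[OF f g walk_cobordism_comp[OF fg h x]]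
  note right = walk3_if_walk_comp_right[OF g h walk_cobordism_comp[OF f gh x]]
  show "app (cmatching ((f \<lhd> g) \<lhd> h)) x = app (cmatching (f \<lhd> (g \<lhd> h))) x"
    \<comment> \<open>Splitting on \<open>x\<close> makes both starting states evaluate to the same
      one, \<open>Inl (Inl a)\<close> or \<open>Inr (Inr (Inr d))\<close>, so the two walks have the
      same end.\<close>
    using left right by (cases x) (auto intro: walk3_deterministic)
qed

section \<open>Identity cobordisms and the unit laws\<close>

lemma id_cobordism_in_cobordisms:
  assumes "A \<in> signed_sets"
  shows "id_cobordism A \<in> cobordisms A A"
proof -
  have "bij_betw (\<lambda>x\<in>pos A <+> neg A. case x of Inl a \<Rightarrow> Inr a | Inr a \<Rightarrow> Inl a)
      (pos A <+> neg A) (neg A <+> pos A)"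
    by (rule bij_betw_byWitness[where f' = "\<lambda>x. case x of Inl a \<Rightarrow> Inr a | Inr a \<Rightarrow> Inl a"]) auto
  then show ?thesis
    using assms by (auto simp: id_cobordism_def cobordisms_def matchings_def signed_sets_def)
qed

lemma id_cobordism_simps:
  "mdom (cmatching (id_cobordism A)) = pos A <+> neg A"
  "a \<in> pos A \<Longrightarrow> app (cmatching (id_cobordism A)) (Inl a) = Inr a"
  "a \<in> neg A \<Longrightarrow> app (cmatching (id_cobordism A)) (Inr a) = Inl a"
  by (auto simp: id_cobordism_def)

lemma id_cobordism_comp:
  assumes f: "f \<in> cobordisms A B"
  shows "id_cobordism A \<lhd> f = f"
proof (rule cobordism_eqI[OF _ f])
  note id = id_cobordism_in_cobordisms[OF cobordismsD(3)[OF f]]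
  note u = cobordismsD(5)[OF f]
  show "id_cobordism A \<lhd> f \<in> cobordisms A B"
    by (rule cobordism_comp_in_cobordisms[OF id f])
  fix x assume x: "x \<in> pos A <+> neg B"
  \<comment> \<open>The walk once it stands at \<open>x\<close> on the side of \<open>f\<close>. A
    point of \<open>neg B\<close> starts there; a point of \<open>pos A\<close> arrives after one
    identity step. If \<open>f\<close> ends in \<open>neg A\<close>, one more identity step leads
    out.\<close>
  have "walk (cmatching (id_cobordism A)) (cmatching f) (Inr x) (app (cmatching f) x)"
  proof (cases "app (cmatching f) x")
    case (Inl a)
    then have "a \<in> neg A"
      using matchingsD(8)[OF u x] by auto
    then show ?thesis
      unfolding Inl using x
      by (intro walk_right_step[OF _ Inl] walk_left_stop)
        (auto simp: matchingsD(1)[OF u] id_cobordism_simps)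
  next
    case (Inr b)
    then show ?thesis
      using x by (auto simp: matchingsD(1)[OF u] intro!: walk_right_stop)
  qed
  then have "walk (cmatching (id_cobordism A)) (cmatching f) (regroup_dom (Inl x)) (app (cmatching f) x)"
    using x by (auto simp: id_cobordism_simps intro!: walk_left_step)
  then show "app (cmatching (id_cobordism A \<lhd> f)) x = app (cmatching f) x"
    by (rule app_cobordism_comp_eqI[OF id f x])
qed

lemma cobordism_comp_id:
  assumes f: "f \<in> cobordisms A B"
  shows "f \<lhd> id_cobordism B = f"
proof (rule cobordism_eqI[OF _ f])
  note id = id_cobordism_in_cobordisms[OF cobordismsD(4)[OF f]]
  note u = cobordismsD(5)[OF f]
  show "f \<lhd> id_cobordism B \<in> cobordisms A B"
    by (rule cobordism_comp_in_cobordisms[OF f id])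
  fix x assume x: "x \<in> pos A <+> neg B"
  \<comment> \<open>Mirror image of the left unit law: here points of \<open>neg B\<close> arrive by
    an identity step, and values in \<open>pos B\<close> leave by one.\<close>
  have "walk (cmatching f) (cmatching (id_cobordism B)) (Inl x) (app (cmatching f) x)"
  proof (cases "app (cmatching f) x")
    case (Inr b)
    then have "b \<in> pos B"
      using matchingsD(8)[OF u x] by auto
    then show ?thesis
      unfolding Inr using x
      by (intro walk_left_step[OF _ Inr] walk_right_stop)
        (auto simp: matchingsD(1)[OF u] id_cobordism_simps)
  next
    case (Inl a)
    then show ?thesis
      using x by (auto simp: matchingsD(1)[OF u] intro!: walk_left_stop)
  qed
  then have "walk (cmatching f) (cmatching (id_cobordism B)) (regroup_dom (Inl x)) (app (cmatching f) x)"
    using x by (auto simp: id_cobordism_simps intro!: walk_right_step)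
  then show "app (cmatching (f \<lhd> id_cobordism B)) x = app (cmatching f) x"
    by (rule app_cobordism_comp_eqI[OF f id x])
qed

theorem category_cobordisms:
  "category (signed_sets :: 'a signed_set set) cobordisms id_cobordism (\<lhd>)"
proof
  show "A = A' \<and> B = B'" if "f \<in> cobordisms A B" "f \<in> cobordisms A' B'"
    for A B A' B' :: "'a signed_set" and f
    using cobordismsD(1,2)[OF that(1)] cobordismsD(1,2)[OF that(2)] by simp
qed (simp_all add: id_cobordism_in_cobordisms cobordism_comp_in_cobordisms id_cobordism_comp
    cobordism_comp_id cobordism_comp_assoc)

section \<open>Unsigned sets and matchings\<close>

lemma matching_comp_in_matchings:
  assumes u: "u \<in> matchings P Q" and v: "v \<in> matchings Q R"
  shows "u \<lhd>\<^sub>m v \<in> matchings P R"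
proof -
  have "bij_betw (app v \<circ> app u) P R"
    by (rule bij_betw_trans[OF matchingsD(6)[OF u] matchingsD(6)[OF v]])
  then have "bij_betw (\<lambda>x\<in>P. app v (app u x)) P R"
    by (simp cong: bij_betw_cong)
  then show ?thesis
    using matchingsD[OF u] matchingsD[OF v] by (simp add: matchings_def matching_comp_def)
qed

lemma id_matching_in_matchings: "finite P \<Longrightarrow> id_matching P \<in> matchings P P"
  by (simp add: matchings_def id_matching_def bij_betw_def inj_on_def)

theorem category_matchings:
  "category (finite_sets :: 'a set set) matchings id_matching (\<lhd>\<^sub>m)"
proof
  show "P = P' \<and> Q = Q'" if "u \<in> matchings P Q" "u \<in> matchings P' Q'"
    for P Q P' Q' :: "'a set" and u
    using matchingsD(1,2)[OF that(1)] matchingsD(1,2)[OF that(2)] by simp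
  show "id_matching P \<in> matchings P P" if "P \<in> finite_sets" for P :: "'a set"
    using that by (simp add: finite_sets_def id_matching_in_matchings)
  show "u \<lhd>\<^sub>m v \<in> matchings P R" if "u \<in> matchings P Q" "v \<in> matchings Q R"
    for P Q R :: "'a set" and u v
    using that by (rule matching_comp_in_matchings)
  show "id_matching P \<lhd>\<^sub>m u = u" if u: "u \<in> matchings P Q" for P Q :: "'a set" and u
    by (rule matching_eqI[OF matching_comp_in_matchings[OF id_matching_in_matchings u] u])
      (simp_all add: matchingsD[OF u] matching_comp_def id_matching_def)
  show "u \<lhd>\<^sub>m id_matching Q = u" if u: "u \<in> matchings P Q" for P Q :: "'a set" and u
    by (rule matching_eqI[OF matching_comp_in_matchings[OF u id_matching_in_matchings] u])
      (simp_all add: matchingsD[OF u] matching_comp_def id_matching_def)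
  show "(u \<lhd>\<^sub>m v) \<lhd>\<^sub>m w = u \<lhd>\<^sub>m (v \<lhd>\<^sub>m w)"
    if "u \<in> matchings P Q" "v \<in> matchings Q R"
    for P Q R S :: "'a set" and u v w
    using that by (auto simp: matching_comp_def matchingsD intro!: restrict_ext)
qed

section \<open>Cobordisms between unsigned sets as matchings\<close>

lemma bij_betw_pos_nonneg:
  "bij_betw pos {A :: 'a signed_set. A \<in> signed_sets \<and> nonneg A} finite_sets"
  by (rule bij_betw_byWitness[where f' = "\<lambda>S. Signed S {}"])
    (auto simp: nonneg_def signed_sets_def finite_sets_def signed_set.expand)

text \<open>With \<open>neg A\<close> empty every value lies in \<open>pos B\<close> and carries the
  tag \<open>Inr\<close>, so \<open>projr\<close> in \<open>unsigned_matching\<close> removes a tag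
  that is really there.\<close>

lemma app_cobordism_nonneg:
  assumes f: "f \<in> cobordisms A B" and "nonneg A" "a \<in> pos A"
  shows "app (cmatching f) (Inl a) = Inr (app (unsigned_matching f) a)"
    and "app (unsigned_matching f) a \<in> pos B"
proof -
  have "app (cmatching f) (Inl a) \<in> neg A <+> pos B"
    using assms(3) by (auto intro: matchingsD(8)[OF cobordismsD(5)[OF f]])
  then show "app (cmatching f) (Inl a) = Inr (app (unsigned_matching f) a)"
    "app (unsigned_matching f) a \<in> pos B"
    using assms(2,3) by (auto simp: nonneg_def unsigned_matching_def cobordismsD(1)[OF f])
qed

lemma unsigned_matching_in_matchings:
  assumes f: "f \<in> cobordisms A B" and A: "nonneg A" and B: "nonneg B"
  shows "unsigned_matching f \<in> matchings (pos A) (pos B)"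
proof -
  note u = cobordismsD(5)[OF f] and app = app_cobordism_nonneg[OF f A]
  have "bij_betw (app (unsigned_matching f)) (pos A) (pos B)"
  proof (rule bij_betwI')
    fix a a' assume a: "a \<in> pos A" "a' \<in> pos A"
    show "app (unsigned_matching f) a = app (unsigned_matching f) a' \<longleftrightarrow> a = a'"
      using inj_onD[OF matchingsD(7)[OF u], of "Inl a" "Inl a'"] app a by auto
  next
    fix b assume "b \<in> pos B"
    \<comment> \<open>A preimage of \<open>Inr b\<close> comes from \<open>pos A\<close>, since
      \<open>neg B\<close> is empty.\<close>
    then have "Inr b \<in> app (cmatching f) ` (pos A <+> neg B)"
      using matchingsD(6)[OF u] by (auto simp: bij_betw_def)
    then show "\<exists>a\<in>pos A. b = app (unsigned_matching f) a"
      using B app by (auto simp: nonneg_def)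
  qed (rule app)
  then show ?thesis
    using cobordismsD(1-4)[OF f] by (simp add: matchings_def unsigned_matching_def signed_sets_def)
qed

lemma bij_betw_unsigned_matching:
  assumes "A \<in> signed_sets" "B \<in> signed_sets" and A: "nonneg A" and B: "nonneg B"
  shows "bij_betw unsigned_matching (cobordisms A B) (matchings (pos A) (pos B))"
proof (rule bij_betwI')
  fix f g assume f: "f \<in> cobordisms A B" and g: "g \<in> cobordisms A B"
  show "unsigned_matching f = unsigned_matching g \<longleftrightarrow> f = g"
  proof
    assume "unsigned_matching f = unsigned_matching g"
    then show "f = g"
      using B by (intro cobordism_eqI[OF f g])
        (auto simp: nonneg_def app_cobordism_nonneg[OF f A] app_cobordism_nonneg[OF g A])
  qed simp
next
  fix u assume u: "u \<in> matchings (pos A) (pos B)"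
  \<comment> \<open>The inverse construction: as \<open>neg B\<close> is empty, every point of the
    domain is \<open>Inl a\<close>, and \<open>f\<close> sends it to the image of \<open>a\<close>
    under \<open>u\<close>, tagged \<open>Inr\<close>.\<close>
  define f where "f = Cobordism (Matching (pos A <+> neg B) (neg A <+> pos B)
    (\<lambda>x\<in>pos A <+> neg B. Inr (app u (projl x)))) A B"
  have "bij_betw (\<lambda>x\<in>pos A <+> neg B. Inr (app u (projl x)) :: 'a + 'b)
      (pos A <+> neg B) (neg A <+> pos B)"
    using matchingsD(6)[OF u] A B
    by (force simp: nonneg_def bij_betw_def inj_on_def image_iff Plus_def)
  then have "f \<in> cobordisms A B"
    using assms by (simp add: f_def cobordisms_def matchings_def signed_sets_def)
  moreover have "unsigned_matching f = u"
  proof (rule matching_eqI[OF unsigned_matching_in_matchings[OF calculation A B] u])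
    show "app (unsigned_matching f) a = app u a" if "a \<in> pos A" for a
      using that by (auto simp: f_def unsigned_matching_def)
  qed
  ultimately show "\<exists>f\<in>cobordisms A B. u = unsigned_matching f"
    by blast
qed (rule unsigned_matching_in_matchings[OF _ A B])

lemma unsigned_matching_id_cobordism:
  "unsigned_matching (id_cobordism A) = id_matching (pos A)"
  by (auto simp: unsigned_matching_def id_matching_def id_cobordism_def intro!: restrict_ext)

lemma unsigned_matching_cobordism_comp:
  assumes f: "f \<in> cobordisms A B" and g: "g \<in> cobordisms B C"
    and A: "nonneg A" and B: "nonneg B" and C: "nonneg C"
  shows "unsigned_matching (f \<lhd> g) = unsigned_matching f \<lhd>\<^sub>m unsigned_matching g"
proof (rule matching_eqI)
  note fg = cobordism_comp_in_cobordisms[OF f g]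
  note f_app = app_cobordism_nonneg[OF f A] and g_app = app_cobordism_nonneg[OF g B]
  show "unsigned_matching (f \<lhd> g) \<in> matchings (pos A) (pos C)"
    by (rule unsigned_matching_in_matchings[OF fg A C])
  show "unsigned_matching f \<lhd>\<^sub>m unsigned_matching g \<in> matchings (pos A) (pos C)"
    by (rule matching_comp_in_matchings[OF unsigned_matching_in_matchings[OF f A B]
          unsigned_matching_in_matchings[OF g B C]])
  fix a assume a: "a \<in> pos A"
  \<comment> \<open>The walk has exactly two steps: \<open>f\<close> leads from \<open>a\<close>
    into \<open>pos B\<close>, and \<open>g\<close> from there into \<open>pos C\<close>, where it
    stops. With \<open>neg B\<close> empty there is no return to \<open>f\<close>.\<close>
  have "app (cmatching (f \<lhd> g)) (Inl a) = Inr (app (unsigned_matching g) (app (unsigned_matching f) a))"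
    using a f_app g_app matchingsD(1)[OF cobordismsD(5)[OF f]] matchingsD(1)[OF cobordismsD(5)[OF g]]
    by (intro app_cobordism_comp_eqI[OF f g]) (auto intro!: walk_left_step walk_right_stop)
  then show "app (unsigned_matching (f \<lhd> g)) a = app (unsigned_matching f \<lhd>\<^sub>m unsigned_matching g) a"
    using app_cobordism_nonneg(1)[OF fg A a] a
    by (simp add: matching_comp_def matchingsD(1)[OF unsigned_matching_in_matchings[OF f A B]])
qed

theorem mainTheorem5:
  shows "category (signed_sets :: 'a signed_set set) cobordisms id_cobordism (\<lhd>)
    \<and> category (finite_sets :: 'a set set) matchings id_matching (\<lhd>\<^sub>m)
    \<and> bij_betw pos {A :: 'a signed_set. A \<in> signed_sets \<and> nonneg A} finite_sets
    \<and> (\<forall>(A :: 'a signed_set) (B :: 'a signed_set).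
        A \<in> signed_sets \<and> B \<in> signed_sets \<and> nonneg A \<and> nonneg B \<longrightarrow>
          bij_betw unsigned_matching (cobordisms A B) (matchings (pos A) (pos B)))
    \<and> (\<forall>A :: 'a signed_set. A \<in> signed_sets \<and> nonneg A \<longrightarrow>
          unsigned_matching (id_cobordism A) = id_matching (pos A))
    \<and> (\<forall>(A :: 'a signed_set) (B :: 'a signed_set) (C :: 'a signed_set) f g.
        A \<in> signed_sets \<and> B \<in> signed_sets \<and> C \<in> signed_sets
        \<and> nonneg A \<and> nonneg B \<and> nonneg C
        \<and> f \<in> cobordisms A B \<and> g \<in> cobordisms B C \<longrightarrow>
          unsigned_matching (f \<lhd> g) = unsigned_matching f \<lhd>\<^sub>m unsigned_matching g)"
  by (intro conjI allI impI; (elim conjE)?)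
    (rule category_cobordisms category_matchings bij_betw_pos_nonneg bij_betw_unsigned_matching
      unsigned_matching_id_cobordism unsigned_matching_cobordism_comp; assumption)+

end
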